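(* Let $f:\omega\to\omega$ be a permutation and suppose the map $\pi$ on Turing degrees defined by $\pi([A]_{\mathrm T})=[f^*(A)]_{\mathrm T}$ for $A\in 2^\omega$ is an automorphism of the Turing degrees $\mathscr D_2=2^\omega/\equiv_{\mathrm T}$ (ordered by Turing reducibility). Then $\pi(\mathbf p)=\mathbf p$ for every Turing degree $\mathbf p$.
   Context: For $f:\omega\to\omega$, the pullback $f^*:\omega^\omega\to\omega^\omega$ is given by $f^*(A)(n)=A(f(n))$; it maps $2^\omega$ (identified with subsets of $\omega$) into $2^\omega$. An automorphism of the Turing degrees is a bijection $\pi$ of the set of Turing degrees such that $\mathbf x\le\mathbf y$ iff $\pi(\mathbf x)\le\pi(\mathbf y)$. Such a $\pi$ is said to be induced by $f$ if $\pi([A])=[f^*(A)]$ for all $A\in 2^\omega$. *)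

theory Defs
  imports Main
begin

text \<open>
  Turing reducibility is Kleene's: a program denotes a partial function of several
  arguments, built from the basic functions and oracular queries \<open>x \<mapsto> A x\<close> by composition, primitive
  recursion and unbounded search. The recursion or search variable is the first argument.
\<close>

datatype prog =
    Zero
  | Succ
  | Proj nat
  | Query
  | Comp prog "prog list"
  | PrimRec prog prog
  | Mu prog

inductive computes :: "(nat \<Rightarrow> nat) \<Rightarrow> prog \<Rightarrow> nat list \<Rightarrow> nat \<Rightarrow> bool" for A :: "nat \<Rightarrow> nat" where
  zero: "computes A Zero xs 0"
| succ: "computes A Succ [x] (Suc x)"
| proj: "i < length xs \<Longrightarrow> computes A (Proj i) xs (xs ! i)"
| query: "computes A Query [x] (A x)"
| comp: "length ys = length gs \<Longrightarrow> (\<And>i. i < length gs \<Longrightarrow> computes A (gs ! i) xs (ys ! i)) \<Longrightarrow>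
    computes A h ys z \<Longrightarrow> computes A (Comp h gs) xs z"
| rec_0: "computes A g xs y \<Longrightarrow> computes A (PrimRec g h) (0 # xs) y"
| rec_Suc: "computes A (PrimRec g h) (n # xs) r \<Longrightarrow> computes A h (n # r # xs) y \<Longrightarrow>
    computes A (PrimRec g h) (Suc n # xs) y"
| mu: "computes A p (n # xs) 0 \<Longrightarrow> (\<And>m. m < n \<Longrightarrow> \<exists>k. computes A p (m # xs) (Suc k)) \<Longrightarrow>
    computes A (Mu p) xs n"

definition turing_le :: "(nat \<Rightarrow> nat) \<Rightarrow> (nat \<Rightarrow> nat) \<Rightarrow> bool" (infix \<open>\<le>\<^sub>T\<close> 50) where
  "B \<le>\<^sub>T A \<longleftrightarrow> (\<exists>p. \<forall>n. computes A p [n] (B n))"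

text \<open>A subset of \<open>\<omega>\<close> is identified with its characteristic function.\<close>

definition cantor_space :: "(nat \<Rightarrow> nat) set" where
  "cantor_space = {A. \<forall>n. A n \<in> {0, 1}}"

definition turing_equiv :: "((nat \<Rightarrow> nat) \<times> (nat \<Rightarrow> nat)) set" where
  "turing_equiv = {(A, B). A \<in> cantor_space \<and> B \<in> cantor_space \<and> A \<le>\<^sub>T B \<and> B \<le>\<^sub>T A}"

definition turing_degree :: "(nat \<Rightarrow> nat) \<Rightarrow> (nat \<Rightarrow> nat) set" where
  "turing_degree A = turing_equiv `` {A}"

definition turing_degrees :: "(nat \<Rightarrow> nat) set set" where
  "turing_degrees = cantor_space // turing_equiv"

definition degree_le :: "(nat \<Rightarrow> nat) set \<Rightarrow> (nat \<Rightarrow> nat) set \<Rightarrow> bool" where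
  "degree_le a b \<longleftrightarrow> (\<exists>A\<in>a. \<exists>B\<in>b. A \<le>\<^sub>T B)"

definition degree_automorphism :: "((nat \<Rightarrow> nat) set \<Rightarrow> (nat \<Rightarrow> nat) set) \<Rightarrow> bool" where
  "degree_automorphism \<pi> \<longleftrightarrow> bij_betw \<pi> turing_degrees turing_degrees \<and>
     (\<forall>a\<in>turing_degrees. \<forall>b\<in>turing_degrees. degree_le a b \<longleftrightarrow> degree_le (\<pi> a) (\<pi> b))"

definition pullback :: "(nat \<Rightarrow> nat) \<Rightarrow> (nat \<Rightarrow> nat) \<Rightarrow> (nat \<Rightarrow> nat)" where
  "pullback f A = (\<lambda>n. A (f n))"

definition induced_by ::
    "((nat \<Rightarrow> nat) set \<Rightarrow> (nat \<Rightarrow> nat) set) \<Rightarrow> (nat \<Rightarrow> nat) \<Rightarrow> bool" where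
  "induced_by \<pi> f \<longleftrightarrow>
     (\<forall>A\<in>cantor_space. \<pi> (turing_degree A) = turing_degree (pullback f A))"

inductive_cases computes_elims:
  "computes A Zero xs y"
  "computes A Succ xs y"
  "computes A (Proj i) xs y"
  "computes A Query xs y"
  "computes A (Comp h gs) xs y"
  "computes A (PrimRec g h) (0 # xs) y"
  "computes A (PrimRec g h) (Suc n # xs) y"
  "computes A (Mu p) xs y"

lemma computes_unique: "computes A p xs y \<Longrightarrow> computes A p xs z \<Longrightarrow> y = z"
proof (induction arbitrary: z rule: computes.induct)
  case (comp ys gs xs h w)
  from comp.prems obtain ys' where ys': "length ys' = length gs"
    "\<And>i. i < length gs \<Longrightarrow> computes A (gs ! i) xs (ys' ! i)" "computes A h ys' z"
    by (auto elim: computes_elims)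
  have "ys = ys'"
    using comp.hyps comp.IH ys' by (auto intro!: nth_equalityI)
  then show ?case using comp.IH ys' by blast
next
  case (mu p n xs)
  from mu.prems have z: "computes A p (z # xs) 0"
    "\<And>m. m < z \<Longrightarrow> \<exists>k. computes A p (m # xs) (Suc k)"
    by (auto elim: computes_elims)
  have "\<not> n < z" using z(2)[of n] mu.IH(1) by fastforce
  moreover have "\<not> z < n" using z(1) mu.IH(2)[of z] by fastforce
  ultimately show ?case by simp
qed (blast elim: computes_elims)+

fun subst_query :: "prog \<Rightarrow> prog \<Rightarrow> prog" where
  "subst_query q Zero = Zero"
| "subst_query q Succ = Succ"
| "subst_query q (Proj i) = Proj i"
| "subst_query q Query = q"
| "subst_query q (Comp h gs) = Comp (subst_query q h) (map (subst_query q) gs)"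
| "subst_query q (PrimRec g h) = PrimRec (subst_query q g) (subst_query q h)"
| "subst_query q (Mu p) = Mu (subst_query q p)"

lemma computes_subst_query:
  assumes "\<And>n. computes B q [n] (A n)"
  shows "computes A p xs y \<Longrightarrow> computes B (subst_query q p) xs y"
proof (induction rule: computes.induct)
  case (comp ys gs xs h z)
  then show ?case by (auto intro!: computes.comp[of ys])
next
  case (mu p n xs)
  then show ?case by (auto intro!: computes.mu)
qed (auto intro: computes.intros assms)

lemma turing_le_refl: "A \<le>\<^sub>T A"
  unfolding turing_le_def by (blast intro: computes.query)

lemma turing_le_trans: "A \<le>\<^sub>T B \<Longrightarrow> B \<le>\<^sub>T C \<Longrightarrow> A \<le>\<^sub>T C"
  unfolding turing_le_def by (blast intro: computes_subst_query)

lemma equiv_turing_equiv: "equiv cantor_space turing_equiv"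
  by (rule equivI)
    (auto simp: turing_equiv_def refl_on_def sym_def trans_def
      intro: turing_le_refl turing_le_trans)

lemma degree_le_turing_degree:
  assumes "A \<in> cantor_space" "B \<in> cantor_space"
  shows "degree_le (turing_degree A) (turing_degree B) \<longleftrightarrow> A \<le>\<^sub>T B"
  using assms turing_le_refl turing_le_trans
  unfolding degree_le_def turing_degree_def turing_equiv_def by blast

end

theory Submission
  imports Defs "HOL-Library.Countable"
begin

text \<open>
  Let \<open>k = f\<^sup>-\<^sup>1 \<circ> Suc \<circ> f\<close>. Since the shift of \<open>B\<close> is computable from \<open>B\<close>, applying the automorphism
  with \<open>C = f\<^sup>*(B)\<close> shows that \<open>C \<circ> k\<close> is computable from \<open>C\<close> for every \<open>C\<close>. By Baire category, a single
  program does this for a dense set of \<open>C\<close> in some cylinder. Wherever that program converges on a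
  finite extension of the cylinder, its answer is the bit at \<open>k n\<close>; comparing two extensions that
  share a single element locates \<open>k n\<close>, so \<open>k\<close> is computable. Then so are
  \<open>f\<^sup>-\<^sup>1(n) = k\<^sup>n(f\<^sup>-\<^sup>1(0))\<close> and \<open>f\<close>, and hence \<open>f\<^sup>*(A)\<close> and \<open>A\<close> have the same degree.
\<close>

section \<open>Total recursive functions\<close>

text \<open>A single program must serve all oracles, so this is recursiveness outright, not relative
  to \<open>A\<close>. The arity is the length of the argument list.\<close>

definition recursive :: "nat \<Rightarrow> (nat list \<Rightarrow> nat) \<Rightarrow> bool" where
  "recursive n F \<longleftrightarrow> (\<exists>p. \<forall>A xs. length xs = n \<longrightarrow> computes A p xs (F xs))"

lemma recursive_cong:
  assumes "recursive n F" "\<And>xs. length xs = n \<Longrightarrow> F xs = G xs"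
  shows "recursive n G"
  using assms unfolding recursive_def by metis

lemma recursive_nth: "i < n \<Longrightarrow> recursive n (\<lambda>xs. xs ! i)"
  unfolding recursive_def by (metis computes.proj)

lemma recursive_comp:
  assumes "recursive (length Gs) H" "\<And>G. G \<in> set Gs \<Longrightarrow> recursive n G"
  shows "recursive n (\<lambda>xs. H (map (\<lambda>G. G xs) Gs))"
proof -
  obtain h where h: "\<And>A xs. length xs = length Gs \<Longrightarrow> computes A h xs (H xs)"
    using assms(1) unfolding recursive_def by blast
  obtain g where g: "\<And>G A xs. G \<in> set Gs \<Longrightarrow> length xs = n \<Longrightarrow> computes A (g G) xs (G xs)"
    using assms(2) unfolding recursive_def by metis
  have "computes A (Comp h (map g Gs)) xs (H (map (\<lambda>G. G xs) Gs))" if "length xs = n" for A xs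
    by (rule computes.comp[where ys = "map (\<lambda>G. G xs) Gs"]) (auto intro: h g that)
  then show ?thesis unfolding recursive_def by blast
qed

lemma recursive_comp1:
  assumes "recursive 1 H" "recursive n F"
  shows "recursive n (\<lambda>xs. H [F xs])"
  using recursive_comp[of "[F]" H n] assms by simp

lemma recursive_comp2:
  assumes "recursive 2 H" "recursive n F" "recursive n G"
  shows "recursive n (\<lambda>xs. H [F xs, G xs])"
  using recursive_comp[of "[F, G]" H n] assms by (auto simp: numeral_2_eq_2)

lemma recursive_drop:
  assumes "recursive n F"
  shows "recursive (k + n) (\<lambda>xs. F (drop k xs))"
proof (rule recursive_cong)
  show "recursive (k + n) (\<lambda>xs. F (map (\<lambda>G. G xs) (map (\<lambda>i xs. xs ! (k + i)) [0..<n])))"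
    by (rule recursive_comp) (auto simp: assms intro: recursive_nth)
  show "F (map (\<lambda>G. G xs) (map (\<lambda>i xs. xs ! (k + i)) [0..<n])) = F (drop k xs)"
    if "length xs = k + n" for xs
    using that by (auto intro!: arg_cong[of _ _ F] nth_equalityI)
qed

lemma recursive_drop2: "recursive n F \<Longrightarrow> recursive (Suc (Suc n)) (\<lambda>xs. F (drop 2 xs))"
  using recursive_drop[of n F 2] by simp

lemma recursive_drop1: "recursive n F \<Longrightarrow> recursive (Suc n) (\<lambda>xs. F (drop 1 xs))"
  using recursive_drop[of n F 1] by simp

lemma recursive_Suc: "recursive n F \<Longrightarrow> recursive n (\<lambda>xs. Suc (F xs))"
proof -
  have "recursive 1 (\<lambda>xs. Suc (hd xs))"
    unfolding recursive_def by (rule exI[of _ Succ]) (auto simp: length_Suc_conv intro: computes.succ)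
  then show "recursive n F \<Longrightarrow> ?thesis"
    using recursive_comp1 by fastforce
qed

lemma recursive_const: "recursive n (\<lambda>xs. c)"
proof (induction c)
  case 0
  then show ?case unfolding recursive_def using computes.zero by blast
qed (rule recursive_Suc)

text \<open>\<open>PrimRec\<close> expects its recursion variable in front, so \<open>N\<close> is
  composed in there and the parameters are passed on by projections.\<close>

lemma recursive_rec_nat:
  assumes "recursive n N" "recursive n G"
    and "recursive (Suc (Suc n)) (\<lambda>ys. H (ys ! 0) (ys ! 1) (drop 2 ys))"
  shows "recursive n (\<lambda>xs. rec_nat (G xs) (\<lambda>m r. H m r xs) (N xs))"
proof -
  obtain g where g: "\<And>A xs. length xs = n \<Longrightarrow> computes A g xs (G xs)"
    using assms(2) unfolding recursive_def by blast
  obtain h where h: "\<And>A xs. length xs = Suc (Suc n) \<Longrightarrow>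
      computes A h xs (H (xs ! 0) (xs ! 1) (drop 2 xs))"
    using assms(3) unfolding recursive_def by blast
  have "computes A (PrimRec g h) (m # xs) (rec_nat (G xs) (\<lambda>m r. H m r xs) m)"
    if "length xs = n" for A m xs
  proof (induction m)
    case (Suc m)
    show ?case
      using computes.rec_Suc[OF Suc] h[of "m # _ # xs"] that by simp
  qed (simp add: computes.rec_0 g that)
  then have rec: "recursive (Suc n) (\<lambda>xs. rec_nat (G (tl xs)) (\<lambda>m r. H m r (tl xs)) (hd xs))"
    unfolding recursive_def by (intro exI[of _ "PrimRec g h"]) (auto simp: length_Suc_conv)
  have "recursive n (\<lambda>xs. rec_nat (G (tl (map (\<lambda>G. G xs) (N # map (\<lambda>i xs. xs ! i) [0..<n]))))
     (\<lambda>m r. H m r (tl (map (\<lambda>G. G xs) (N # map (\<lambda>i xs. xs ! i) [0..<n]))))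
     (hd (map (\<lambda>G. G xs) (N # map (\<lambda>i xs. xs ! i) [0..<n]))))"
    by (rule recursive_comp) (use rec assms(1) in \<open>auto intro: recursive_nth\<close>)
  moreover have "map (\<lambda>i. xs ! i) [0..<n] = xs" if "length xs = n" for xs :: "nat list"
    using map_nth that by blast
  ultimately show ?thesis
    by (elim recursive_cong) (simp add: comp_def)
qed

lemma recursive_Least:
  assumes "recursive (Suc n) (\<lambda>ys. F (ys ! 0) (drop 1 ys))"
    and "\<And>xs. length xs = n \<Longrightarrow> \<exists>w. F w xs = 0"
  shows "recursive n (\<lambda>xs. LEAST w. F w xs = 0)"
proof -
  obtain p where p: "\<And>A xs. length xs = Suc n \<Longrightarrow> computes A p xs (F (xs ! 0) (drop 1 xs))"
    using assms(1) unfolding recursive_def by blast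
  have "computes A (Mu p) xs (LEAST w. F w xs = 0)" if xs: "length xs = n" for A xs
  proof (rule computes.mu)
    have F: "computes A p (w # xs) (F w xs)" for w
      using p[of "w # xs"] xs by simp
    show "computes A p ((LEAST w. F w xs = 0) # xs) 0"
      using F LeastI_ex[OF assms(2)[OF xs]] by metis
    show "\<exists>k. computes A p (m # xs) (Suc k)" if "m < (LEAST w. F w xs = 0)" for m
      using F[of m] not_less_Least[OF that] by (metis not0_implies_Suc)
  qed
  then show ?thesis unfolding recursive_def by blast
qed

text \<open>Case distinction is a primitive recursion whose step function ignores both the counter
  and the previous value.\<close>

lemma recursive_if_0:
  assumes "recursive n X" "recursive n F" "recursive n G"
  shows "recursive n (\<lambda>xs. if X xs = 0 then F xs else G xs)"
proof (rule recursive_cong)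
  show "recursive n (\<lambda>xs. rec_nat (F xs) (\<lambda>_ _. G xs) (X xs))"
    by (intro recursive_rec_nat assms recursive_drop2)
  show "rec_nat (F xs) (\<lambda>_ _. G xs) (X xs) = (if X xs = 0 then F xs else G xs)" for xs
    by (cases "X xs") auto
qed

lemma recursive_pred:
  assumes "recursive n F"
  shows "recursive n (\<lambda>xs. F xs - 1)"
proof (rule recursive_cong)
  show "recursive n (\<lambda>xs. rec_nat 0 (\<lambda>m _. m) (F xs))"
    by (intro recursive_rec_nat assms recursive_const recursive_nth) simp
  show "rec_nat 0 (\<lambda>m _. m) (F xs) = F xs - 1" for xs
    by (cases "F xs") auto
qed

lemma recursive_add:
  assumes "recursive n F" "recursive n G"
  shows "recursive n (\<lambda>xs. F xs + G xs)"
proof (rule recursive_cong)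
  show "recursive n (\<lambda>xs. rec_nat (F xs) (\<lambda>_ r. Suc r) (G xs))"
    by (intro recursive_rec_nat assms recursive_Suc recursive_nth) simp
  have "rec_nat a (\<lambda>_ r. Suc r) b = a + b" for a b :: nat
    by (induction b) auto
  then show "rec_nat (F xs) (\<lambda>_ r. Suc r) (G xs) = F xs + G xs" for xs
    by simp
qed

lemma recursive_diff:
  assumes "recursive n F" "recursive n G"
  shows "recursive n (\<lambda>xs. F xs - G xs)"
proof (rule recursive_cong)
  show "recursive n (\<lambda>xs. rec_nat (F xs) (\<lambda>_ r. r - 1) (G xs))"
    by (intro recursive_rec_nat assms recursive_pred recursive_nth) simp
  have "rec_nat a (\<lambda>_ r. r - 1) b = a - b" for a b :: nat
    by (induction b) auto
  then show "rec_nat (F xs) (\<lambda>_ r. r - 1) (G xs) = F xs - G xs" for xs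
    by simp
qed

lemma recursive_mult:
  assumes "recursive n F" "recursive n G"
  shows "recursive n (\<lambda>xs. F xs * G xs)"
proof (rule recursive_cong)
  show "recursive n (\<lambda>xs. rec_nat 0 (\<lambda>_ r. r + F xs) (G xs))"
    by (intro recursive_rec_nat assms recursive_add recursive_const recursive_nth recursive_drop2) simp
  have "rec_nat 0 (\<lambda>_ r. r + a) b = a * b" for a b :: nat
    by (induction b) auto
  then show "rec_nat 0 (\<lambda>_ r. r + F xs) (G xs) = F xs * G xs" for xs
    by simp
qed

lemma recursive_if_eq:
  assumes "recursive n X" "recursive n Y" "recursive n F" "recursive n G"
  shows "recursive n (\<lambda>xs. if X xs = Y xs then F xs else G xs)"
proof (rule recursive_cong)
  show "recursive n (\<lambda>xs. if (X xs - Y xs) + (Y xs - X xs) = 0 then F xs else G xs)"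
    by (intro recursive_if_0 recursive_add recursive_diff assms)
qed auto

text \<open>\<open>c\<close> is arbitrary: finitely many values can be hard-wired into a program,
  one comparison for each.\<close>

lemma recursive_table:
  assumes "finite S" "recursive n X" "recursive n F"
  shows "recursive n (\<lambda>xs. if X xs \<in> S then c (X xs) else F xs)"
  using assms(1)
proof (induction S rule: finite_induct)
  case (insert a S)
  have "recursive n (\<lambda>xs. if X xs = a then c a else (if X xs \<in> S then c (X xs) else F xs))"
    by (intro recursive_if_eq insert.IH assms recursive_const)
  then show ?case by (rule recursive_cong) auto
qed (simp add: assms)

lemma recursive_imp_turing_le:
  assumes "recursive 1 (\<lambda>xs. g (xs ! 0))"
  shows "pullback g A \<le>\<^sub>T A"
proof -
  obtain p where p: "\<And>n. computes A p [n] (g n)"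
    using assms unfolding recursive_def by (metis One_nat_def length_Cons list.size(3) nth_Cons_0)
  have "computes A (Comp Query [p]) [n] (A (g n))" for n
    by (rule computes.comp[of "[g n]"]) (auto intro: p computes.query)
  then show ?thesis
    unfolding turing_le_def pullback_def by blast
qed

section \<open>Coding finite sequences\<close>

text \<open>The integer square root, put as a least zero so that \<open>Mu\<close> computes it: the
  truncated difference vanishes exactly when \<open>w\<close> is below the square of
  \<open>Suc r\<close>.\<close>

definition nat_root :: "nat \<Rightarrow> nat" where
  "nat_root w = (LEAST r. Suc w - Suc r * Suc r = 0)"

definition code_fst :: "nat \<Rightarrow> nat" where
  "code_fst w = w - nat_root w * nat_root w"

text \<open>Together with \<open>code_fst\<close> this decodes pairs: one component is the excess of
  \<open>w\<close> over the largest square, the other is the same excess for the root of that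
  square. Every pair has arbitrarily large codes.\<close>

definition code_snd :: "nat \<Rightarrow> nat" where
  "code_snd w = code_fst (nat_root w)"

definition entry :: "nat \<Rightarrow> nat \<Rightarrow> nat" where
  "entry w i = code_fst (rec_nat w (\<lambda>_. code_snd) i)"

lemma nat_root_eq: "a \<le> 2 * q \<Longrightarrow> nat_root (q * q + a) = q"
  unfolding nat_root_def
proof (rule Least_equality)
  fix r assume r: "Suc (q * q + a) - Suc r * Suc r = 0"
  show "q \<le> r"
  proof (rule ccontr)
    assume "\<not> q \<le> r"
    then have "Suc r * Suc r \<le> q * q"
      by (intro mult_le_mono) auto
    with r show False by simp
  qed
qed auto

lemma code_fst_eq: "a \<le> 2 * q \<Longrightarrow> code_fst (q * q + a) = a"
  by (simp add: code_fst_def nat_root_eq)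

lemma code_ex: "\<exists>w\<ge>s. code_fst w = a \<and> code_snd w = b"
proof -
  \<comment> \<open>The summands secure \<open>b \<le> 2 * N\<close> and
    \<open>a \<le> 2 * q\<close>, as the root formula demands, and push the code past
    \<open>s\<close>.\<close>
  define N where "N = s + a + b"
  define q where "q = N * N + b"
  have "N \<le> q"
    using le_square[of N] unfolding q_def by linarith
  then have q: "s \<le> q" "a \<le> q"
    by (simp_all add: N_def)
  have "s \<le> q * q + a"
    using q(1) le_square[of q] by linarith
  moreover have "code_fst (q * q + a) = a" "nat_root (q * q + a) = q"
    using q by (auto intro: code_fst_eq nat_root_eq)
  moreover have "code_fst q = b"
    unfolding q_def by (rule code_fst_eq) (simp add: N_def)
  ultimately show ?thesis
    unfolding code_snd_def by metis
qed

lemma entry_0: "entry w 0 = code_fst w"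
  by (simp add: entry_def)

lemma entry_Suc: "entry w (Suc i) = entry (code_snd w) i"
proof -
  have "rec_nat w (\<lambda>_. code_snd) (Suc i) = rec_nat (code_snd w) (\<lambda>_. code_snd) i"
    by (induction i) auto
  then show ?thesis by (simp add: entry_def)
qed

text \<open>The head is paired with a code of the tail. Arbitrarily large codes are wanted because
  the code will also serve as the stage that bounds all searches.\<close>

lemma entry_ex: "\<exists>w\<ge>s. \<forall>i<u. entry w i = c i"
proof (induction u arbitrary: c)
  case (Suc u)
  obtain v where v: "\<forall>i<u. entry v i = c (Suc i)"
    using Suc[of "\<lambda>i. c (Suc i)"] by blast
  obtain w where w: "w \<ge> s" "code_fst w = c 0" "code_snd w = v"
    using code_ex by blast
  then have "entry w i = c i" if "i < Suc u" for i
    using v that by (cases i) (auto simp: entry_0 entry_Suc)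
  with w(1) show ?case by blast
qed auto

lemma recursive_nat_root:
  assumes "recursive n F"
  shows "recursive n (\<lambda>xs. nat_root (F xs))"
  unfolding nat_root_def
proof (rule recursive_Least)
  show "recursive (Suc n) (\<lambda>ys. Suc (F (drop 1 ys)) - Suc (ys ! 0) * Suc (ys ! 0))"
    by (intro recursive_diff recursive_Suc recursive_mult recursive_nth recursive_drop1 assms) auto
  show "\<exists>w. Suc (F xs) - Suc w * Suc w = 0" for xs
    by (rule exI[of _ "F xs"]) simp
qed

lemma recursive_code_fst: "recursive n F \<Longrightarrow> recursive n (\<lambda>xs. code_fst (F xs))"
  unfolding code_fst_def by (intro recursive_diff recursive_mult recursive_nat_root)

lemma recursive_code_snd: "recursive n F \<Longrightarrow> recursive n (\<lambda>xs. code_snd (F xs))"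
  unfolding code_snd_def by (intro recursive_code_fst recursive_nat_root)

lemma recursive_entry:
  "recursive n F \<Longrightarrow> recursive n G \<Longrightarrow> recursive n (\<lambda>xs. entry (F xs) (G xs))"
  unfolding entry_def
  by (intro recursive_code_fst recursive_rec_nat recursive_code_snd recursive_nth) auto

section \<open>Evaluation with bounded search\<close>

text \<open>The accumulator is \<open>0\<close> while the search is running, \<open>1\<close> after it has failed, and \<open>j + 2\<close> after
  it has found \<open>j\<close>.\<close>

definition search :: "(nat \<Rightarrow> nat) \<Rightarrow> nat \<Rightarrow> nat" where
  "search b s =
    rec_nat 0 (\<lambda>j r. if r = 0 then if b j = 0 then 1 else if b j = 1 then Suc (Suc j) else 0 else r) s"

lemma search_Suc:
  "search b (Suc j) =
    (if search b j = 0 then if b j = 0 then 1 else if b j = 1 then Suc (Suc j) else 0 else search b j)"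
  by (simp add: search_def)

lemma search_running: "search b s = 0 \<longleftrightarrow> (\<forall>j<s. b j \<ge> 2)"
proof (induction s)
  case (Suc s)
  then show ?case by (auto simp: search_Suc less_Suc_eq)
qed (simp add: search_def)

lemma search_found: "search b s = Suc (Suc i) \<Longrightarrow> b i = 1 \<and> (\<forall>j<i. b j \<ge> 2)"
proof (induction s)
  case (Suc s)
  then show ?case
    by (auto simp: search_Suc search_running split: if_splits)
qed (simp add: search_def)

lemma search_eq:
  assumes "b n = 1" "\<And>j. j < n \<Longrightarrow> b j \<ge> 2" "n < s"
  shows "search b s = Suc (Suc n)"
  using assms(3)
proof (induction s)
  case (Suc s)
  have "search b n = 0"
    using assms(2) by (simp add: search_running)
  with Suc assms(1) show ?case
    by (auto simp: search_Suc less_Suc_eq)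
qed simp

text \<open>The result \<open>Suc y\<close> means that \<open>y\<close> was computed with every search stopping below \<open>s\<close>,
  and \<open>0\<close> means failure.\<close>

fun bounded_eval :: "(nat \<Rightarrow> nat) \<Rightarrow> nat \<Rightarrow> prog \<Rightarrow> nat list \<Rightarrow> nat" where
  "bounded_eval A s Zero xs = 1"
| "bounded_eval A s Succ xs = (if length xs = 1 then Suc (Suc (xs ! 0)) else 0)"
| "bounded_eval A s (Proj i) xs = (if i < length xs then Suc (xs ! i) else 0)"
| "bounded_eval A s Query xs = (if length xs = 1 then Suc (A (xs ! 0)) else 0)"
| "bounded_eval A s (Comp h gs) xs =
    (if \<exists>g\<in>set gs. bounded_eval A s g xs = 0 then 0
     else bounded_eval A s h (map (\<lambda>g. bounded_eval A s g xs - 1) gs))"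
| "bounded_eval A s (PrimRec g h) xs =
    (if length xs = 0 then 0
     else rec_nat (bounded_eval A s g (drop 1 xs))
       (\<lambda>m r. if r = 0 then 0 else bounded_eval A s h (m # (r - 1) # drop 1 xs)) (xs ! 0))"
| "bounded_eval A s (Mu p) xs =
    search (\<lambda>j. bounded_eval A s p (j # xs)) s - 1"

lemma bounded_eval_sound: "bounded_eval A s p xs = Suc y \<Longrightarrow> computes A p xs y"
proof (induction p arbitrary: xs y)
  case (Comp h gs)
  then have nz: "\<And>g. g \<in> set gs \<Longrightarrow> bounded_eval A s g xs \<noteq> 0"
    and h: "bounded_eval A s h (map (\<lambda>g. bounded_eval A s g xs - 1) gs) = Suc y"
    by (auto split: if_splits)
  show ?case
  proof (rule computes.comp[where ys = "map (\<lambda>g. bounded_eval A s g xs - 1) gs"])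
    show "computes A (gs ! i) xs (map (\<lambda>g. bounded_eval A s g xs - 1) gs ! i)"
      if "i < length gs" for i
      using that nz[of "gs ! i"] by (auto intro: Comp.IH(2))
    show "computes A h (map (\<lambda>g. bounded_eval A s g xs - 1) gs) y"
      by (rule Comp.IH(1)) (rule h)
  qed simp
next
  case (PrimRec g h)
  then obtain n zs where xs: "xs = n # zs"
    by (cases xs) auto
  let ?r = "rec_nat (bounded_eval A s g zs)
    (\<lambda>m r. if r = 0 then 0 else bounded_eval A s h (m # (r - 1) # zs))"
  have "?r n = Suc y \<Longrightarrow> computes A (PrimRec g h) (n # zs) y" for n y
  proof (induction n arbitrary: y)
    case 0
    then show ?case by (auto intro: computes.rec_0 PrimRec.IH(1))
  next
    case (Suc n)
    then obtain r where "?r n = Suc r"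
      by (cases "?r n") auto
    with Suc show ?case
      by (auto intro!: computes.rec_Suc[of _ _ _ _ _ r] PrimRec.IH(2))
  qed
  then show ?case using PrimRec.prems xs by (simp cong: if_cong)
next
  case (Mu p)
  let ?b = "\<lambda>j. bounded_eval A s p (j # xs)"
  \<comment> \<open>The decrement in the \<open>Mu\<close> clause turns the states 0 and 1 into
    failure and \<open>j + 2\<close> into \<open>Suc j\<close>, so the final state here is
    \<open>y + 2\<close>.\<close>
  have y: "?b y = 1" "\<And>j. j < y \<Longrightarrow> ?b j \<ge> 2"
    using search_found[of ?b s y] Mu.prems by auto
  show ?case
  proof (rule computes.mu)
    show "computes A p (y # xs) 0"
      using y(1) Mu.IH by simp
    show "\<exists>k. computes A p (m # xs) (Suc k)" if "m < y" for m
      using y(2)[OF that] Mu.IH[of "m # xs" "?b m - 1"]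
      by (intro exI[of _ "?b m - 2"]) (simp add: numeral_2_eq_2 Suc_diff_Suc)
  qed
qed (auto split: if_splits simp: length_Suc_conv intro: computes.intros)

text \<open>The use principle: a halting computation queries only a finite part of the oracle and
  searches only finitely far. One \<open>u\<close> bounds both, so the result transfers to every
  oracle that agrees below \<open>u\<close>.\<close>

lemma bounded_eval_complete:
  assumes "computes A p xs y"
  shows "\<exists>u. \<forall>s\<ge>u. \<forall>A'. (\<forall>i<u. A' i = A i) \<longrightarrow> bounded_eval A' s p xs = Suc y"
  using assms
proof (induction rule: computes.induct)
  case (query x)
  show ?case by (rule exI[of _ "Suc x"]) auto
next
  case (comp ys gs xs h z)
  obtain u where u: "\<And>i s A'. i < length gs \<Longrightarrow> u i \<le> s \<Longrightarrow> (\<forall>j<u i. A' j = A j) \<Longrightarrow>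
      bounded_eval A' s (gs ! i) xs = Suc (ys ! i)"
    using comp.IH(1) by metis
  obtain v where v: "\<And>s A'. v \<le> s \<Longrightarrow> (\<forall>j<v. A' j = A j) \<Longrightarrow> bounded_eval A' s h ys = Suc z"
    using comp.IH(2) by blast
  \<comment> \<open>The sum dominates each of its finitely many terms and so bounds all
    subcomputations at once.\<close>
  define w where "w = v + (\<Sum>i<length gs. u i)"
  have uw: "u i \<le> w" if "i < length gs" for i
    unfolding w_def using member_le_sum[of i "{..<length gs}" u] that by simp
  have "bounded_eval A' s (Comp h gs) xs = Suc z" if s: "w \<le> s" and A': "\<forall>j<w. A' j = A j" for s A'
  proof -
    have g: "bounded_eval A' s (gs ! i) xs = Suc (ys ! i)" if "i < length gs" for i
      by (rule u[OF that]) (use uw[OF that] s A' in auto)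
    then have "map (\<lambda>g. bounded_eval A' s g xs - 1) gs = ys"
      using comp.hyps by (auto intro!: nth_equalityI)
    moreover have "\<forall>g\<in>set gs. bounded_eval A' s g xs \<noteq> 0"
      using g by (auto simp: in_set_conv_nth)
    moreover have "bounded_eval A' s h ys = Suc z"
      by (rule v) (use s A' in \<open>auto simp: w_def\<close>)
    ultimately show ?thesis by auto
  qed
  then show ?case by blast
next
  case (rec_Suc g h n xs r y)
  obtain u where u: "\<And>s A'. u \<le> s \<Longrightarrow> (\<forall>j<u. A' j = A j) \<Longrightarrow>
      bounded_eval A' s (PrimRec g h) (n # xs) = Suc r"
    using rec_Suc.IH(1) by blast
  obtain v where v: "\<And>s A'. v \<le> s \<Longrightarrow> (\<forall>j<v. A' j = A j) \<Longrightarrow>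
      bounded_eval A' s h (n # r # xs) = Suc y"
    using rec_Suc.IH(2) by blast
  have "bounded_eval A' s (PrimRec g h) (Suc n # xs) = Suc y"
    if "max u v \<le> s" "\<forall>j<max u v. A' j = A j" for s A'
    using u[of s A'] v[of s A'] that by (simp cong: if_cong)
  then show ?case by blast
next
  case (mu p n xs)
  obtain u where u: "\<And>s A'. u \<le> s \<Longrightarrow> (\<forall>j<u. A' j = A j) \<Longrightarrow>
      bounded_eval A' s p (n # xs) = 1"
    using mu.IH(1) by auto
  have "\<exists>v. \<forall>s\<ge>v. \<forall>A'. (\<forall>i<v. A' i = A i) \<longrightarrow> bounded_eval A' s p (m # xs) \<ge> 2" if "m < n" for m
    using mu.IH(2)[OF that] by (metis One_nat_def Suc_1 Suc_le_mono le0)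
  then obtain v where v: "\<And>m s A'. m < n \<Longrightarrow> v m \<le> s \<Longrightarrow> (\<forall>j<v m. A' j = A j) \<Longrightarrow>
      bounded_eval A' s p (m # xs) \<ge> 2"
    by metis
  \<comment> \<open>\<open>Suc n\<close> lets the search reach \<open>n\<close>; the other terms
    cover the calls at \<open>n\<close> and at all smaller arguments.\<close>
  define w where "w = Suc n + u + (\<Sum>m<n. v m)"
  have vw: "v m \<le> w" if "m < n" for m
    unfolding w_def using member_le_sum[of m "{..<n}" v] that by simp
  have "bounded_eval A' s (Mu p) xs = Suc n" if s: "w \<le> s" and A': "\<forall>j<w. A' j = A j" for s A'
  proof -
    have "search (\<lambda>j. bounded_eval A' s p (j # xs)) s = Suc (Suc n)"
    proof (rule search_eq)
      show "bounded_eval A' s p (n # xs) = 1"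
        by (rule u) (use s A' in \<open>auto simp: w_def\<close>)
      show "bounded_eval A' s p (m # xs) \<ge> 2" if "m < n" for m
        by (rule v[OF that]) (use vw[OF that] s A' in auto)
      show "n < s" using s by (simp add: w_def)
    qed
    then show ?thesis by simp
  qed
  then show ?case by blast
qed auto

section \<open>Recursiveness of the bounded evaluator\<close>

lemma recursive_search:
  assumes "recursive n S" "recursive (Suc n) (\<lambda>ys. b (ys ! 0) (drop 1 ys))"
  shows "recursive n (\<lambda>xs. search (\<lambda>j. b j xs) (S xs))"
proof -
  \<comment> \<open>The recursion step sees \<open>j\<close>, the accumulator and the parameters;
    \<open>b\<close> must skip the accumulator.\<close>
  have b: "recursive (Suc (Suc n)) (\<lambda>ys. b (ys ! 0) (drop 2 ys))"
  proof (rule recursive_cong)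
    let ?Gs = "(\<lambda>ys. ys ! 0) # map (\<lambda>i ys. ys ! (i + 2)) [0..<n]"
    show "recursive (Suc (Suc n))
        (\<lambda>ys. b (map (\<lambda>G. G ys) ?Gs ! 0) (drop 1 (map (\<lambda>G. G ys) ?Gs)))"
      by (rule recursive_comp) (use assms(2) in \<open>auto intro: recursive_nth\<close>)
    show "b (map (\<lambda>G. G ys) ?Gs ! 0) (drop 1 (map (\<lambda>G. G ys) ?Gs)) = b (ys ! 0) (drop 2 ys)"
      if "length ys = Suc (Suc n)" for ys
      using that by (auto intro!: arg_cong[of _ _ "b (ys ! 0)"] nth_equalityI)
  qed
  show ?thesis
    unfolding search_def
    by (intro recursive_rec_nat assms(1) recursive_if_0 recursive_if_eq recursive_Suc
        recursive_const recursive_nth b) auto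
qed

text \<open>The list is fixed, so the existential unrolls into nested conditionals.\<close>

lemma recursive_if_Bex_0:
  assumes "\<And>g. g \<in> set gs \<Longrightarrow> recursive n (E g)" "recursive n F"
  shows "recursive n (\<lambda>xs. if \<exists>g\<in>set gs. E g xs = 0 then 0 else F xs)"
  using assms(1)
proof (induction gs)
  case (Cons g gs)
  have "recursive n (\<lambda>xs. if E g xs = 0 then 0 else if \<exists>g\<in>set gs. E g xs = 0 then 0 else F xs)"
    by (intro recursive_if_0 recursive_const Cons.IH Cons.prems) auto
  then show ?case by (rule recursive_cong) auto
qed (simp add: assms(2))

text \<open>The number \<open>ys ! 0\<close> is both the code of the oracle and the stage, so that
  later a single search variable suffices. The induction on the program keeps the arity general
  because subprograms are called with other argument counts.\<close>

lemma recursive_bounded_eval: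
  assumes "recursive 2 (\<lambda>ys. Q (ys ! 0) (ys ! 1))"
  shows "recursive (Suc n) (\<lambda>ys. bounded_eval (Q (ys ! 0)) (ys ! 0) p (drop 1 ys))"
proof (induction p arbitrary: n)
  case Zero
  then show ?case by (simp add: recursive_const)
next
  case Succ
  show ?case
  proof (cases "n = 1")
    case True
    have "recursive (Suc n) (\<lambda>ys. Suc (Suc (ys ! 1)))"
      using True by (intro recursive_Suc recursive_nth) auto
    then show ?thesis by (rule recursive_cong) (simp add: True)
  next
    case False
    show ?thesis by (rule recursive_cong[OF recursive_const[of _ 0]]) (use False in simp)
  qed
next
  case (Proj i)
  show ?case
  proof (cases "i < n")
    case True
    then have "recursive (Suc n) (\<lambda>ys. Suc (ys ! Suc i))"
      by (intro recursive_Suc recursive_nth) auto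
    then show ?thesis by (rule recursive_cong) (simp add: True)
  next
    case False
    show ?thesis by (rule recursive_cong[OF recursive_const[of _ 0]]) (use False in simp)
  qed
next
  case Query
  show ?case
  proof (cases "n = 1")
    case True
    have "recursive (Suc n) (\<lambda>ys. Suc (Q ([ys ! 0, ys ! 1] ! 0) ([ys ! 0, ys ! 1] ! 1)))"
      using True by (intro recursive_Suc recursive_comp2[OF assms] recursive_nth) auto
    then show ?thesis by (rule recursive_cong) (simp add: True)
  next
    case False
    show ?thesis by (rule recursive_cong[OF recursive_const[of _ 0]]) (use False in simp)
  qed
next
  case (Comp h gs)
  let ?E = "\<lambda>g ys. bounded_eval (Q (ys ! 0)) (ys ! 0) g (drop 1 ys)"
  \<comment> \<open>The stage stays in front and the values of the inner programs follow it.\<close>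
  let ?Gs = "(\<lambda>ys. ys ! 0) # map (\<lambda>g ys. ?E g ys - 1) gs"
  have "recursive (Suc n) (\<lambda>ys. ?E h (map (\<lambda>G. G ys) ?Gs))"
    by (rule recursive_comp)
      (use Comp.IH(1)[of "length gs"] in \<open>auto intro!: recursive_nth recursive_pred[simplified] Comp.IH(2)[simplified]\<close>)
  then have "recursive (Suc n)
      (\<lambda>ys. if \<exists>g\<in>set gs. ?E g ys = 0 then 0 else ?E h (map (\<lambda>G. G ys) ?Gs))"
    by (intro recursive_if_Bex_0 Comp.IH(2))
  then show ?case by (rule recursive_cong) (auto simp: comp_def)
next
  case (PrimRec g h)
  let ?E = "\<lambda>g ys. bounded_eval (Q (ys ! 0)) (ys ! 0) g (drop 1 ys)"
  show ?case
  proof (cases n)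
    case 0
    show ?thesis by (rule recursive_cong[OF recursive_const[of _ 0]]) (simp add: 0)
  next
    case (Suc k)
    let ?Gs = "(\<lambda>ys :: nat list. ys ! 0) # map (\<lambda>i ys. ys ! (i + 2)) [0..<k]"
    \<comment> \<open>The recursion step receives counter, previous result, stage, recursion
      argument, parameters; \<open>h\<close> wants stage, counter, decoded result,
      parameters.\<close>
    let ?Hs = "(\<lambda>ys :: nat list. ys ! 2) # (\<lambda>ys. ys ! 0) # (\<lambda>ys. ys ! 1 - 1) #
      map (\<lambda>i ys. ys ! (i + 4)) [0..<k]"
    have g: "recursive (Suc n) (\<lambda>ys. ?E g (map (\<lambda>G. G ys) ?Gs))"
      by (rule recursive_comp) (use PrimRec.IH(1)[of k] Suc in \<open>auto intro: recursive_nth\<close>)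
    have g': "recursive (Suc n) (\<lambda>ys. bounded_eval (Q (ys ! 0)) (ys ! 0) g (drop 2 ys))"
    proof (rule recursive_cong[OF g])
      fix ys :: "nat list" assume "length ys = Suc n"
      then have "map (\<lambda>i. ys ! (i + 2)) [0..<k] = drop 2 ys"
        using Suc by (auto intro!: nth_equalityI)
      then show "?E g (map (\<lambda>G. G ys) ?Gs) = bounded_eval (Q (ys ! 0)) (ys ! 0) g (drop 2 ys)"
        by (simp add: comp_def)
    qed
    have h: "recursive (Suc (Suc (Suc n))) (\<lambda>ys. ?E h (map (\<lambda>G. G ys) ?Hs))"
      by (rule recursive_comp)
        (use PrimRec.IH(2)[of "Suc (Suc k)"] Suc in \<open>auto intro!: recursive_nth recursive_pred[simplified]\<close>)
    have h': "recursive (Suc (Suc (Suc n)))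
      (\<lambda>ys. bounded_eval (Q (drop 2 ys ! 0)) (drop 2 ys ! 0) h
        (ys ! 0 # (ys ! 1 - 1) # drop 2 (drop 2 ys)))"
    proof (rule recursive_cong[OF h])
      fix ys :: "nat list" assume len: "length ys = Suc (Suc (Suc n))"
      then have "map (\<lambda>i. ys ! (i + 4)) [0..<k] = drop 4 ys"
        using Suc by (auto intro!: nth_equalityI simp: add.commute)
      then show "?E h (map (\<lambda>G. G ys) ?Hs) =
          bounded_eval (Q (drop 2 ys ! 0)) (drop 2 ys ! 0) h (ys ! 0 # (ys ! 1 - 1) # drop 2 (drop 2 ys))"
        using len by (simp add: comp_def)
    qed
    have "recursive (Suc n) (\<lambda>ys. rec_nat (bounded_eval (Q (ys ! 0)) (ys ! 0) g (drop 2 ys))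
       (\<lambda>m r. if r = 0 then 0 else bounded_eval (Q (ys ! 0)) (ys ! 0) h (m # (r - 1) # drop 2 ys))
       (ys ! 1))"
      by (intro recursive_rec_nat recursive_if_0 recursive_nth recursive_const g' h') (auto simp: Suc)
    then show ?thesis by (rule recursive_cong) (auto simp: Suc numeral_2_eq_2 cong: if_cong)
  qed
next
  case (Mu p)
  \<comment> \<open>The search puts its variable before the stage; the two are swapped back.\<close>
  let ?Gs = "(\<lambda>ys :: nat list. ys ! 1) # (\<lambda>ys. ys ! 0) # map (\<lambda>i ys. ys ! (i + 2)) [0..<n]"
  let ?E = "\<lambda>ys. bounded_eval (Q (ys ! 0)) (ys ! 0) p (drop 1 ys)"
  have p: "recursive (Suc (Suc n)) (\<lambda>ys. ?E (map (\<lambda>G. G ys) ?Gs))"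
    by (rule recursive_comp) (use Mu.IH[of "Suc n"] in \<open>auto intro: recursive_nth\<close>)
  have p': "recursive (Suc (Suc n))
    (\<lambda>ys. bounded_eval (Q (drop 1 ys ! 0)) (drop 1 ys ! 0) p (ys ! 0 # drop 1 (drop 1 ys)))"
  proof (rule recursive_cong[OF p])
    fix ys :: "nat list" assume len: "length ys = Suc (Suc n)"
    then have "map (\<lambda>i. ys ! (i + 2)) [0..<n] = drop 2 ys"
      by (auto intro!: nth_equalityI)
    then show "?E (map (\<lambda>G. G ys) ?Gs) =
        bounded_eval (Q (drop 1 ys ! 0)) (drop 1 ys ! 0) p (ys ! 0 # drop 1 (drop 1 ys))"
      using len by (simp add: comp_def numeral_2_eq_2)
  qed
  show ?case
    unfolding bounded_eval.simps
    by (intro recursive_pred recursive_search recursive_nth p') simp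
qed

section \<open>A pullback below every oracle\<close>

instance prog :: countable
  by countable_datatype

text \<open>Baire category: countably many programs cover Cantor space, so one of them succeeds on a
  dense subset of a cylinder.\<close>

lemma somewhere_dense_program:
  assumes "\<And>C. C \<in> cantor_space \<Longrightarrow> \<exists>p. P p C"
  shows "\<exists>p. \<exists>C\<in>cantor_space. \<exists>l. \<forall>C'\<in>cantor_space. \<forall>u. (\<forall>i<l. C' i = C i) \<longrightarrow>
    (\<exists>D\<in>cantor_space. (\<forall>i<u. D i = C' i) \<and> P (p :: prog) D)"
proof (rule ccontr)
  assume contra: "\<not> ?thesis"
  \<comment> \<open>A condition is a set together with a length. Here \<open>c'\<close> is a
    strictly longer condition extending \<open>c\<close>, and \<open>p\<close> succeeds nowhere in
    its cylinder.\<close>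
  define good where "good c p c' \<longleftrightarrow> fst c' \<in> cantor_space \<and> snd c < snd c' \<and>
    (\<forall>i<snd c. fst c' i = fst c i) \<and>
    (\<forall>D\<in>cantor_space. (\<forall>i<snd c'. D i = fst c' i) \<longrightarrow> \<not> P p D)"
    for c c' :: "(nat \<Rightarrow> nat) \<times> nat" and p
  have step: "\<exists>c'. good c p c'" if C: "fst c \<in> cantor_space" for c p
  proof -
    obtain C' u where C': "C' \<in> cantor_space" "\<forall>i<snd c. C' i = fst c i"
      "\<forall>D\<in>cantor_space. (\<forall>i<u. D i = C' i) \<longrightarrow> \<not> P p D"
      using contra C by metis
    then have "good c p (C', max u (Suc (snd c)))"
      unfolding good_def by auto
    then show ?thesis by blast
  qed
  \<comment> \<open>Stage \<open>j\<close> defeats the program numbered \<open>j\<close>.\<close>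
  define c where "c = rec_nat (\<lambda>_. 0, 0) (\<lambda>j r. SOME c'. good r (from_nat j) c')"
  have cantor: "fst (c j) \<in> cantor_space" for j
  proof (induction j)
    case (Suc j)
    have "good (c j) (from_nat j) (c (Suc j))"
      using someI_ex[OF step[OF Suc]] by (simp add: c_def)
    then show ?case by (simp add: good_def)
  qed (simp add: c_def cantor_space_def)
  have good: "good (c j) (from_nat j) (c (Suc j))" for j
    using someI_ex[OF step[OF cantor]] by (simp add: c_def)
  have less: "j \<le> snd (c j)" for j
  proof (induction j)
    case (Suc j)
    then show ?case using good[of j] unfolding good_def by linarith
  qed simp
  have agree: "snd (c j) \<le> snd (c k) \<and> (\<forall>i<snd (c j). fst (c k) i = fst (c j) i)" if "j \<le> k" for j k
    using that
  proof (induction k rule: dec_induct)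
    case (step k)
    then show ?case using good[of k] unfolding good_def by auto
  qed auto
  \<comment> \<open>The condition \<open>c (Suc i)\<close> already has length above
    \<open>i\<close>, so bit \<open>i\<close> is settled there.\<close>
  define D where "D i = fst (c (Suc i)) i" for i
  have "D \<in> cantor_space"
    using cantor unfolding D_def cantor_space_def by auto
  then obtain p where p: "P p D"
    using assms by blast
  have D: "D i = fst (c j) i" if i: "i < snd (c j)" for i j
  proof (cases "j \<le> Suc i")
    case True
    then show ?thesis using agree[OF True] i by (simp add: D_def)
  next
    case False
    moreover have "i < snd (c (Suc i))" using less[of "Suc i"] by simp
    ultimately show ?thesis using agree[of "Suc i" j] by (simp add: D_def)
  qed
  \<comment> \<open>\<open>D\<close> lies in the cylinder built at stage \<open>to_nat p\<close>, on
    which \<open>p\<close> was defeated.\<close>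
  have "\<not> P p D"
    using good[of "to_nat p"] D \<open>D \<in> cantor_space\<close> unfolding good_def by simp
  with p show False by simp
qed

text \<open>The search for \<open>k n\<close> runs over numbers that code a candidate, two oracles
  and a stage at once. Injectivity leaves only finitely many \<open>n\<close> with
  \<open>k n\<close> in the stem of the cylinder, where the oracles cannot vary.\<close>

lemma recursive_if_pullback_le:
  assumes "inj k" and le: "\<And>C. C \<in> cantor_space \<Longrightarrow> pullback k C \<le>\<^sub>T C"
  shows "recursive 1 (\<lambda>xs. k (xs ! 0))"
proof -
  define P where "P p D \<longleftrightarrow> (\<forall>n. computes D p [n] (D (k n)))" for p D
  have "\<exists>p. P p C" if "C \<in> cantor_space" for C
    using le[OF that] unfolding turing_le_def pullback_def P_def .
  then obtain p C l where C: "C \<in> cantor_space" and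
    dense: "\<And>C' u. C' \<in> cantor_space \<Longrightarrow> (\<And>i. i < l \<Longrightarrow> C' i = C i) \<Longrightarrow>
      \<exists>D\<in>cantor_space. (\<forall>i<u. D i = C' i) \<and> P p D"
    using somewhere_dense_program[of P] by metis
  text \<open>Both oracles \<open>Q 1 w\<close> and \<open>Q 2 w\<close> extend the condition, and above it they meet only in the
    number \<open>entry w 0\<close>. If \<open>p\<close> answers \<open>1\<close> at \<open>n\<close> with both of them, then \<open>k n\<close> must be that number.\<close>
  define Q where "Q e w x = (if x \<in> {..<l} then C x else if x = entry w 0 then 1 else
    if entry w (Suc x) = e then 1 else 0)" for e w x
  define bad where "bad = {n. k n < l}"
  \<comment> \<open>Success is the value 0, as \<open>Mu\<close> requires, and the evaluator's
    result 2 stands for the answer 1. On \<open>bad\<close> the search stops at once; a table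
    supplies the values of \<open>k\<close> there afterwards.\<close>
  define F where "F w n = (if n \<in> bad then 0 :: nat else
    if bounded_eval (Q 1 w) w p [n] = 2 then if bounded_eval (Q 2 w) w p [n] = 2 then 0 else 1 else 1)"
    for w n :: nat
  have cantor: "Q e w \<in> cantor_space" for e w
    using C by (auto simp: Q_def cantor_space_def)
  have fin: "finite bad"
    unfolding bad_def using finite_vimageI[OF finite_lessThan[of l] \<open>inj k\<close>] by (simp add: vimage_def)
  have rec_Q: "recursive 2 (\<lambda>ys. Q e (ys ! 0) (ys ! 1))" for e
    unfolding Q_def
    by (intro recursive_table[where X = "\<lambda>ys. ys ! 1" and c = C] recursive_if_eq recursive_entry
        recursive_Suc recursive_const recursive_nth) auto
  have rec_eval: "recursive 2 (\<lambda>ys. bounded_eval (Q e (ys ! 0)) (ys ! 0) p [ys ! 1])" for e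
  proof (rule recursive_cong)
    show "recursive 2 (\<lambda>ys. bounded_eval (Q e (ys ! 0)) (ys ! 0) p (drop 1 ys))"
      using recursive_bounded_eval[OF rec_Q, of 1 e p] by (simp add: numeral_2_eq_2)
  qed (auto simp: numeral_2_eq_2 length_Suc_conv)
  \<comment> \<open>Success of \<open>p\<close> is known only on a dense set, perhaps not at
    \<open>Q e w\<close> itself. The computation uses finitely many bits, so a successful
    \<open>D\<close> agreeing past that use and past \<open>k n\<close> yields the same answer,
    which is its bit at \<open>k n\<close>.\<close>
  have answer: "Q e w (k n) = 1" if ev: "bounded_eval (Q e w) w p [n] = 2" for e w n
  proof -
    have "computes (Q e w) p [n] 1"
      by (rule bounded_eval_sound[of _ w]) (use ev in simp)
    from bounded_eval_complete[OF this] obtain u where u: "\<And>s A'. u \<le> s \<Longrightarrow> (\<forall>i<u. A' i = Q e w i) \<Longrightarrow>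
        bounded_eval A' s p [n] = Suc 1"
      by blast
    obtain D where D: "\<forall>i<max u (Suc (k n)). D i = Q e w i" "P p D"
      using dense[OF cantor, of e w "max u (Suc (k n))"] by (auto simp: Q_def)
    have "computes D p [n] 1"
      by (rule bounded_eval_sound[of _ u], rule u) (use D(1) in auto)
    moreover have "computes D p [n] (D (k n))"
      using D(2) by (simp add: P_def)
    ultimately have "D (k n) = 1"
      using computes_unique by blast
    then show ?thesis using D(1) by auto
  qed
  have sound: "entry w 0 = k n" if "F w n = 0" "n \<notin> bad" for w n
  proof -
    have "bounded_eval (Q 1 w) w p [n] = 2" "bounded_eval (Q 2 w) w p [n] = 2"
      using that by (simp_all add: F_def split: if_splits)
    then have "Q 1 w (k n) = 1" "Q 2 w (k n) = 1"
      by (blast intro: answer)+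
    \<comment> \<open>If \<open>k n\<close> were not the candidate, its entry would have to be 1 for
      one oracle and 2 for the other.\<close>
    moreover have "Q e w (k n) = (if entry w 0 = k n \<or> entry w (Suc (k n)) = e then 1 else 0)" for e
      using that(2) by (auto simp: Q_def bad_def)
    ultimately show ?thesis
      by (metis One_nat_def n_not_Suc_n numeral_2_eq_2 zero_neq_one)
  qed
  have complete: "\<exists>w. F w n = 0" for n
  proof (cases "n \<in> bad")
    case True
    then show ?thesis by (simp add: F_def)
  next
    case False
    define m where "m = k n"
    have m: "l \<le> m" using False by (simp add: bad_def m_def)
    \<comment> \<open>A successful \<open>D\<close> near \<open>C'\<close> contains \<open>m\<close>
      because \<open>m < v\<close>, so \<open>p\<close> answers 1 on it, with a use bounded by
      \<open>u\<close>.\<close>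
    have use: "\<exists>D u. D \<in> cantor_space \<and> (\<forall>i<v. D i = C' i) \<and>
        (\<forall>s\<ge>u. \<forall>A'. (\<forall>i<u. A' i = D i) \<longrightarrow> bounded_eval A' s p [n] = 2)"
      if C': "C' \<in> cantor_space" "\<And>i. i < l \<Longrightarrow> C' i = C i" "C' m = 1" "m < v" for C' v
    proof -
      obtain D where D: "D \<in> cantor_space" "\<forall>i<v. D i = C' i" "P p D"
        using dense[OF C'(1,2)] by metis
      then have "computes D p [n] 1"
        using C'(3,4) unfolding P_def m_def by metis
      from bounded_eval_complete[OF this] D(1,2) show ?thesis
        by (auto simp: numeral_2_eq_2)
    qed
    define C1 where "C1 i = (if i < l then C i else 1)" for i
    have "C1 \<in> cantor_space" "\<And>i. i < l \<Longrightarrow> C1 i = C i" "C1 m = 1"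
      using C m by (auto simp: C1_def cantor_space_def)
    from use[OF this, of "Suc m"] obtain D1 u1 where D1: "D1 \<in> cantor_space" "\<forall>i<Suc m. D1 i = C1 i"
        "\<And>s A'. u1 \<le> s \<Longrightarrow> (\<forall>i<u1. A' i = D1 i) \<Longrightarrow> bounded_eval A' s p [n] = 2"
      by blast
    \<comment> \<open>The second oracle is chosen after the first. Below \<open>v\<close>, where the
      first is consulted, it is zero apart from the stem and \<open>m\<close>; from \<open>v\<close>
      on only the second is consulted. So the consulted parts share just \<open>m\<close> above the
      stem.\<close>
    define v where "v = max u1 (Suc m)"
    define C2 where "C2 i = (if i < l then C i else if i = m then 1 else 0)" for i
    have "C2 \<in> cantor_space" "\<And>i. i < l \<Longrightarrow> C2 i = C i" "C2 m = 1"
      using C m by (auto simp: C2_def cantor_space_def)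
    moreover have "m < v" by (simp add: v_def)
    ultimately obtain D2 u2 where D2: "D2 \<in> cantor_space" "\<forall>i<v. D2 i = C2 i"
        "\<And>s A'. u2 \<le> s \<Longrightarrow> (\<forall>i<u2. A' i = D2 i) \<Longrightarrow> bounded_eval A' s p [n] = 2"
      using use[of C2 v] by blast
    define code where "code i = (case i of 0 \<Rightarrow> m | Suc x \<Rightarrow>
      if x < v then (if D1 x = 1 then 1 else 0) else if D2 x = 1 then 2 else 0)" for i
    obtain w where w: "max u1 u2 \<le> w" "\<forall>i<Suc (max u1 u2). entry w i = code i"
      using entry_ex by blast
    have w0: "entry w 0 = m" using w(2) by (simp add: code_def)
    have wS: "entry w (Suc x) = code (Suc x)" if "x < max u1 u2" for x
      using w(2) that by simp
    have bits: "D1 x = 0 \<or> D1 x = 1" "D2 x = 0 \<or> D2 x = 1" for x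
      using D1(1) D2(1) by (auto simp: cantor_space_def)
    have "Q 1 w x = D1 x" if "x < u1" for x
      using that wS[of x] bits[of x] D1(2) m by (auto simp: Q_def w0 code_def v_def C1_def)
    then have "bounded_eval (Q 1 w) w p [n] = 2"
      using w(1) by (intro D1(3)) auto
    moreover have "Q 2 w x = D2 x" if "x < u2" for x
      using that wS[of x] bits[of x] D2(2) m
      by (cases "x < v") (auto simp: Q_def w0 code_def C2_def v_def)
    then have "bounded_eval (Q 2 w) w p [n] = 2"
      using w(1) by (intro D2(3)) auto
    ultimately show ?thesis by (auto simp: F_def)
  qed
  have "recursive 2 (\<lambda>ys. F (ys ! 0) (ys ! 1))"
    unfolding F_def
    by (intro recursive_table[where X = "\<lambda>ys. ys ! 1" and c = "\<lambda>_. 0"] fin recursive_if_eq rec_eval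
        recursive_const recursive_nth) auto
  then have "recursive (Suc 1) (\<lambda>ys. F (ys ! 0) (drop 1 ys ! 0))"
    by (simp add: numeral_2_eq_2) (erule recursive_cong, simp)
  then have "recursive 1 (\<lambda>xs. LEAST w. F w (xs ! 0) = 0)"
    by (rule recursive_Least) (rule complete)
  then have "recursive 1 (\<lambda>xs. if xs ! 0 \<in> bad then k (xs ! 0) else entry (LEAST w. F w (xs ! 0) = 0) 0)"
    by (intro recursive_table[where X = "\<lambda>xs. xs ! 0"] fin recursive_nth recursive_entry recursive_const) auto
  then show ?thesis
    by (rule recursive_cong) (use sound LeastI_ex[OF complete] in auto)
qed

section \<open>Recovering the permutation, and the conclusion\<close>

lemma pullback_Suc_le: "pullback Suc B \<le>\<^sub>T B"
  by (rule recursive_imp_turing_le) (intro recursive_Suc recursive_nth, simp)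

text \<open>The inverse of \<open>f\<close> is recovered by iterating the conjugate of the successor function.\<close>

lemma recursive_if_conjugate_Suc:
  assumes "bij f" "recursive 1 (\<lambda>xs. inv f (Suc (f (xs ! 0))))"
  shows "recursive 1 (\<lambda>xs. f (xs ! 0))" "recursive 1 (\<lambda>xs. inv f (xs ! 0))"
proof -
  have f: "f (inv f x) = x" "inv f (f x) = x" for x
    using assms(1) by (simp_all add: bij_is_surj surj_f_inv_f bij_is_inj)
  have "recursive 1 (\<lambda>xs. rec_nat (inv f 0) (\<lambda>_ r. inv f (Suc (f ([r] ! 0)))) (xs ! 0))"
    by (intro recursive_rec_nat recursive_nth recursive_const recursive_comp1[OF assms(2)]) auto
  moreover have "rec_nat (inv f 0) (\<lambda>_ r. inv f (Suc (f ([r] ! 0)))) n = inv f n" for n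
    by (induction n) (simp_all add: f)
  ultimately show inv: "recursive 1 (\<lambda>xs. inv f (xs ! 0))"
    by simp
  \<comment> \<open>\<open>f n\<close> is the only \<open>w\<close> with \<open>inv f w = n\<close>,
    so unbounded search finds it.\<close>
  have "recursive (Suc 1) (\<lambda>ys. if inv f (ys ! 0) = drop 1 ys ! 0 then 0 else 1)"
  proof (rule recursive_cong)
    show "recursive (Suc 1) (\<lambda>ys. if inv f ([ys ! 0] ! 0) = ys ! 1 then 0 else 1)"
      by (intro recursive_if_eq recursive_comp1[OF inv] recursive_nth recursive_const) auto
  qed simp
  then have "recursive 1 (\<lambda>xs. LEAST w. (if inv f w = xs ! 0 then 0 else 1 :: nat) = 0)"
    by (rule recursive_Least) (use f in auto)
  moreover have "(LEAST w. (if inv f w = n then 0 else 1 :: nat) = 0) = f n" for n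
    by (rule Least_equality) (auto simp: f split: if_splits)
  ultimately show "recursive 1 (\<lambda>xs. f (xs ! 0))"
    by simp
qed

theorem theorem5p1:
  fixes f :: "nat \<Rightarrow> nat"
    and \<pi> :: "(nat \<Rightarrow> nat) set \<Rightarrow> (nat \<Rightarrow> nat) set"
  assumes "bij f"
    and "induced_by \<pi> f"
    and "degree_automorphism \<pi>"
  shows "\<forall>p\<in>turing_degrees. \<pi> p = p"
proof
  have f: "f (inv f x) = x" "inv f (f x) = x" for x
    using assms(1) by (simp_all add: bij_is_surj surj_f_inv_f bij_is_inj)
  have cantor: "pullback g A \<in> cantor_space" if "A \<in> cantor_space" for g A
    using that by (simp add: cantor_space_def pullback_def)
  have "pullback (\<lambda>n. inv f (Suc (f n))) C \<le>\<^sub>T C" if C: "C \<in> cantor_space" for C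
  proof -
    \<comment> \<open>Chosen so that \<open>f\<close> pulls \<open>B\<close> back to
      \<open>C\<close>, and the shift of \<open>B\<close> back to \<open>C\<close> composed with the
      conjugate of \<open>Suc\<close>.\<close>
    define B where "B = pullback (inv f) C"
    have B: "B \<in> cantor_space" "pullback Suc B \<in> cantor_space"
      by (auto simp: B_def intro: cantor C)
    have "degree_le (turing_degree (pullback Suc B)) (turing_degree B)"
      using B pullback_Suc_le by (simp add: degree_le_turing_degree)
    moreover have "turing_degree X \<in> turing_degrees" if "X \<in> cantor_space" for X
      using that unfolding turing_degrees_def turing_degree_def by (rule quotientI)
    ultimately have "degree_le (\<pi> (turing_degree (pullback Suc B))) (\<pi> (turing_degree B))"
      using assms(3) B unfolding degree_automorphism_def by blast
    then have "pullback f (pullback Suc B) \<le>\<^sub>T pullback f B"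
      using assms(2) B cantor unfolding induced_by_def by (simp add: degree_le_turing_degree)
    then show ?thesis
      by (simp add: B_def pullback_def f)
  qed
  moreover have "inj (\<lambda>n. inv f (Suc (f n)))"
    by (rule injI) (metis f nat.inject)
  ultimately have "recursive 1 (\<lambda>xs. inv f (Suc (f (xs ! 0))))"
    by (intro recursive_if_pullback_le)
  note rec = recursive_if_conjugate_Suc[OF assms(1) this]
  fix p assume "p \<in> turing_degrees"
  then obtain A where A: "A \<in> cantor_space" "p = turing_degree A"
    unfolding turing_degrees_def turing_degree_def by (auto elim: quotientE)
  have "pullback f A \<le>\<^sub>T A"
    by (rule recursive_imp_turing_le[OF rec(1)])
  \<comment> \<open>Pulling \<open>pullback f A\<close> back along \<open>inv f\<close> returns
    \<open>A\<close>.\<close>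
  moreover have "A \<le>\<^sub>T pullback f A"
    using recursive_imp_turing_le[OF rec(2), of "pullback f A"] by (simp add: pullback_def f)
  ultimately have "(pullback f A, A) \<in> turing_equiv"
    using A(1) cantor by (simp add: turing_equiv_def)
  then have "turing_degree (pullback f A) = turing_degree A"
    unfolding turing_degree_def by (rule equiv_class_eq[OF equiv_turing_equiv])
  then show "\<pi> p = p"
    using assms(2) A unfolding induced_by_def by simp
qed

end
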